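(* Let $k$ be a field of arbitrary characteristic, let $B$ be a $k$-domain and let $\delta\in\mathrm{EXP}(B)$ be such that $B^{\delta}$ is an affine $k$-algebra. If the plinth ideal $\mathrm{pl}(\delta)$ contains a quasi-basic element of $B$, then $B^{\delta}$ is non-rigid.
   Context: A $k$-domain is an integral domain containing the field $k$; "affine" means finitely generated as a $k$-algebra. An exponential map $\delta\in \mathrm{EXP}(B)$ on a $k$-domain $B$ is a family $\{D_n\}_{n\ge 0}$ of $k$-linear endomorphisms of $B$ such that: (1) $D_0=\mathrm{id}$; (2) for every $b\in B$ there is $n>0$ with $D_i(b)=0$ for all $i\ge n$; (3) $D_n(xy)=\sum_{i=0}^n D_i(x)D_{n-i}(y)$ for all $x,y\in B$, $n\ge 0$; (4) $D_j\circ D_i=\binom{i+j}{j}D_{i+j}$ for all $i,j\ge 0$. One also views $\delta$ as the $k$-algebra homomorphism $\delta:B\to B[t]$, $\delta(b)=\sum_n D_n(b)t^n$. The ring of invariants is $B^\delta=\{b\in B:\delta(b)=b\}$; $\delta$ is non-trivial if $B^\delta\ne B$. $lc_\delta(x)$ denotes the leading coefficient of $\delta(x)\in B[t]$ in $t$, i.e. $D_m(x)$ with $m=\deg_t\delta(x)$. A local slice of $\delta$ is an element $x\in B$ such that $\deg_t\delta(x)$ is positive and minimal among the positive $t$-degrees of elements $\delta(b)$, $b\in B$. The plinth ideal is $\mathrm{pl}(\delta)=\{lc_\delta(x): x \text{ a local slice of }\delta\}\cup\{0\}$, an ideal of $B^\delta$. A non-zero element $x\in B$ is quasi-basic if there are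 two non-trivial exponential maps $\alpha,\beta$ of $B$ with $B^{\alpha}\neq B^{\beta}$ and $x\in B^{\alpha}\cap B^{\beta}$. A $k$-domain is rigid if it has no non-trivial exponential map, and non-rigid otherwise. *)

theory Defs
  imports "HOL-Computational_Algebra.Polynomial"
begin

text \<open>
  Rings are subsets of an ambient type of class \<open>idom\<close>, so that a ring of invariants, and
  exponential maps of it, can be treated in the same way as the ring it lives in.
  Maps are total functions on the ambient type; only their values on the carrier matter.
\<close>

definition is_subring :: "'b::idom set \<Rightarrow> bool" where
  "is_subring A \<longleftrightarrow> 1 \<in> A \<and> (\<forall>x\<in>A. \<forall>y\<in>A. x - y \<in> A \<and> x * y \<in> A)"

definition is_subfield :: "'b::idom set \<Rightarrow> bool" where
  "is_subfield k \<longleftrightarrow> is_subring k \<and> (\<forall>x\<in>k. x \<noteq> 0 \<longrightarrow> (\<exists>y\<in>k. x * y = 1))"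

locale k_domain =
  fixes k B :: "'b::idom set"
  assumes subfield: "is_subfield k"
    and subring: "is_subring B"
    and subset: "k \<subseteq> B"

definition affine_algebra :: "'b::idom set \<Rightarrow> 'b set \<Rightarrow> bool" where
  "affine_algebra k A \<longleftrightarrow> k_domain k A \<and> (\<exists>S. finite S \<and> A = (k_domain k) hull S)"

locale exponential_map = k_domain k B for k B :: "'b::idom set" +
  fixes D :: "nat \<Rightarrow> 'b \<Rightarrow> 'b"
  assumes closed: "x \<in> B \<Longrightarrow> D n x \<in> B"
    and add: "x \<in> B \<Longrightarrow> y \<in> B \<Longrightarrow> D n (x + y) = D n x + D n y"
    and scale: "c \<in> k \<Longrightarrow> x \<in> B \<Longrightarrow> D n (c * x) = c * D n x"
    and zero: "x \<in> B \<Longrightarrow> D 0 x = x"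
    and locally_finite: "x \<in> B \<Longrightarrow> \<exists>n>0. \<forall>i\<ge>n. D i x = 0"
    and leibniz: "x \<in> B \<Longrightarrow> y \<in> B \<Longrightarrow> D n (x * y) = (\<Sum>i=0..n. D i x * D (n - i) y)"
    and iterative: "x \<in> B \<Longrightarrow> D j (D i x) = of_nat ((i + j) choose j) * D (i + j) x"

text \<open>
  The polynomial \<open>\<delta>(b) = \<Sum>\<^sub>n D\<^sub>n(b) t\<^sup>n\<close>. The use of \<open>Abs_poly\<close> is meaningful only where
  \<open>D\<^sub>n(b) = 0\<close> for almost all \<open>n\<close>, which \<open>locally_finite\<close> guarantees on the carrier.
\<close>

definition exp_poly :: "(nat \<Rightarrow> 'b::idom \<Rightarrow> 'b) \<Rightarrow> 'b \<Rightarrow> 'b poly" where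
  "exp_poly D b = Abs_poly (\<lambda>n. D n b)"

definition invariants :: "'b::idom set \<Rightarrow> (nat \<Rightarrow> 'b \<Rightarrow> 'b) \<Rightarrow> 'b set" where
  "invariants B D = {b \<in> B. exp_poly D b = [:b:]}"

definition nontrivial_exp :: "'b::idom set \<Rightarrow> (nat \<Rightarrow> 'b \<Rightarrow> 'b) \<Rightarrow> bool" where
  "nontrivial_exp B D \<longleftrightarrow> invariants B D \<noteq> B"

definition local_slice :: "'b::idom set \<Rightarrow> (nat \<Rightarrow> 'b \<Rightarrow> 'b) \<Rightarrow> 'b \<Rightarrow> bool" where
  "local_slice B D x \<longleftrightarrow> x \<in> B \<and> degree (exp_poly D x) > 0 \<and>
     (\<forall>b\<in>B. degree (exp_poly D b) > 0 \<longrightarrow> degree (exp_poly D x) \<le> degree (exp_poly D b))"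

definition plinth :: "'b::idom set \<Rightarrow> (nat \<Rightarrow> 'b \<Rightarrow> 'b) \<Rightarrow> 'b set" where
  "plinth B D = {lead_coeff (exp_poly D x) | x. local_slice B D x} \<union> {0}"

definition quasi_basic :: "'b::idom set \<Rightarrow> 'b set \<Rightarrow> 'b \<Rightarrow> bool" where
  "quasi_basic k B x \<longleftrightarrow> x \<in> B \<and> x \<noteq> 0 \<and>
     (\<exists>\<alpha> \<beta>. exponential_map k B \<alpha> \<and> nontrivial_exp B \<alpha> \<and>
            exponential_map k B \<beta> \<and> nontrivial_exp B \<beta> \<and>
            invariants B \<alpha> \<noteq> invariants B \<beta> \<and>
            x \<in> invariants B \<alpha> \<inter> invariants B \<beta>)"

definition rigid :: "'b::idom set \<Rightarrow> 'b set \<Rightarrow> bool" where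
  "rigid k A \<longleftrightarrow> \<not> (\<exists>D. exponential_map k A D \<and> nontrivial_exp A D)"

end

theory Submission
  imports Defs
begin

text \<open>
  Let \<open>A = B\<^sup>\<delta>\<close>, let \<open>x\<close> be a local slice and \<open>f\<close> the leading coefficient of \<open>\<delta>(x)\<close>, chosen such
  that \<open>f\<close> is quasi-basic. After inverting \<open>f\<close>, the ring \<open>B\<close> becomes the polynomial ring
  \<open>A\<^sub>f[x]\<close>: the element \<open>x\<close> is transcendental over \<open>A\<close>, and every \<open>b \<in> B\<close> has a multiple
  \<open>f\<^sup>M b\<close> in \<open>A[x]\<close> (\<open>local_slice_transcendental\<close>, \<open>local_slice_generates\<close>). Hence an exponential
  map that fixes \<open>A\<close> and is non-trivial has exactly \<open>A\<close> as its invariants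
  (\<open>invariants_subset_imp_eq\<close>). Of two non-trivial exponential maps with distinct rings of
  invariants that both fix \<open>f\<close>, at least one, say \<open>\<gamma>\<close>, therefore moves an element of \<open>A\<close>.

  Since \<open>f\<close> is \<open>\<gamma>\<close>-invariant, multiplying the \<open>n\<close>-th component of \<open>\<gamma>\<close> by \<open>f\<^sup>M\<^sup>n\<close> gives another
  exponential map of \<open>B\<close>. As \<open>A\<close> is finitely generated, a single large \<open>M\<close> clears all
  denominators, and the new map \<open>D\<close> restricts to \<open>A[x]\<close> (\<open>not_rigid_invariants\<close>). It remains to
  produce a non-trivial exponential map of \<open>A\<close> from an exponential map \<open>D\<close> of the polynomial ring
  \<open>A[x]\<close> that moves \<open>A\<close> (\<open>not_rigid_base_of_polynomial_extension\<close>).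

  This is done by passing to the leading form of \<open>D\<close> for the \<open>x\<close>-degree. Let \<open>s = p/q\<close> be the
  largest slope \<open>(deg D\<^sub>n(y) - deg y) / n\<close>, where \<open>n > 0\<close>, \<open>D\<^sub>n(y) \<noteq> 0\<close> and \<open>y\<close> is \<open>x\<close> or one of finitely
  many generators of \<open>A\<close>. Then every \<open>D\<^sub>n\<close> raises degrees by at most \<open>s n\<close>, and retaining only the part
  of degree exactly \<open>deg + s n\<close> yields a homogeneous exponential map of \<open>A[x]\<close>. Because \<open>A\<close> is moved,
  \<open>s \<ge> 0\<close>. This forces the homogeneous map to fix \<open>x\<close>: if the highest component not annihilating
  \<open>x\<close> had index \<open>m > 0\<close>, then it would send \<open>x\<close> to \<open>c x\<^sup>l\<close> with \<open>c \<noteq> 0\<close> and \<open>l = 1 + s m \<ge> 1\<close>. As a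
  leading coefficient this element would be invariant, yet its image has \<open>t\<close>-degree at least \<open>l m > 0\<close>
  (\<open>lead_form_gen\<close>). Setting \<open>x = 1\<close> therefore gives an exponential map of \<open>A\<close>
  (\<open>exponential_map_induced\<close>). It is non-trivial because the slope \<open>s\<close> is attained, and not at \<open>x\<close>, hence
  at a generator of \<open>A\<close> (\<open>induced_nontrivial\<close>).
\<close>

section \<open>Subrings and polynomials over them\<close>

lemma is_subring_closed:
  assumes "is_subring A"
  shows is_subring_one: "1 \<in> A"
    and is_subring_zero: "0 \<in> A"
    and is_subring_diff: "\<lbrakk>a \<in> A; b \<in> A\<rbrakk> \<Longrightarrow> a - b \<in> A"
    and is_subring_mult: "\<lbrakk>a \<in> A; b \<in> A\<rbrakk> \<Longrightarrow> a * b \<in> A"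
    and is_subring_add: "\<lbrakk>a \<in> A; b \<in> A\<rbrakk> \<Longrightarrow> a + b \<in> A"
proof -
  show 1: "1 \<in> A" using assms by (simp add: is_subring_def)
  show d: "\<lbrakk>a \<in> A; b \<in> A\<rbrakk> \<Longrightarrow> a - b \<in> A" for a b
    using assms by (simp add: is_subring_def)
  show "\<lbrakk>a \<in> A; b \<in> A\<rbrakk> \<Longrightarrow> a * b \<in> A"
    using assms by (simp add: is_subring_def)
  show 0: "0 \<in> A" using d[OF 1 1] by simp
  show "\<lbrakk>a \<in> A; b \<in> A\<rbrakk> \<Longrightarrow> a + b \<in> A"
    using d[OF _ d[OF 0, of b], of a] by simp
qed

lemma is_subring_power: "is_subring A \<Longrightarrow> a \<in> A \<Longrightarrow> a ^ n \<in> A"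
  by (induction n) (auto simp: is_subring_closed)

lemma is_subring_sum: "is_subring A \<Longrightarrow> (\<And>i. i \<in> I \<Longrightarrow> g i \<in> A) \<Longrightarrow> sum g I \<in> A"
  by (induction I rule: infinite_finite_induct) (auto simp: is_subring_closed)

lemma is_subring_of_nat: "is_subring A \<Longrightarrow> of_nat n \<in> A"
  by (induction n) (auto simp: is_subring_closed)

lemmas is_subring_intros =
  is_subring_one is_subring_zero is_subring_diff is_subring_mult is_subring_add
  is_subring_power is_subring_sum

definition poly_over :: "'b::idom set \<Rightarrow> 'b poly set" where
  "poly_over A = {P. \<forall>i. coeff P i \<in> A}"

definition adjoin :: "'b::idom set \<Rightarrow> 'b \<Rightarrow> 'b set" where
  "adjoin A x = (\<lambda>P. poly P x) ` poly_over A"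

lemma pCons_in_poly_over: "pCons a P \<in> poly_over A \<longleftrightarrow> a \<in> A \<and> P \<in> poly_over A"
  unfolding poly_over_def by (auto simp: coeff_pCons split: nat.splits)

lemma is_subring_poly_over: "is_subring A \<Longrightarrow> is_subring (poly_over A)"
  unfolding is_subring_def[of "poly_over A"]
  by (auto simp: poly_over_def coeff_mult is_subring_intros intro!: is_subring_sum
      split: if_splits)

lemma is_subring_adjoin:
  assumes "is_subring A"
  shows "is_subring (adjoin A x)"
  unfolding is_subring_def
proof (intro conjI ballI)
  note P = is_subring_poly_over[OF assms]
  show "1 \<in> adjoin A x"
    unfolding adjoin_def using is_subring_one[OF P] by (rule rev_image_eqI) simp
  fix u v assume "u \<in> adjoin A x" "v \<in> adjoin A x"
  then obtain U V where UV: "U \<in> poly_over A" "V \<in> poly_over A" "u = poly U x" "v = poly V x"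
    unfolding adjoin_def by auto
  show "u - v \<in> adjoin A x"
    unfolding adjoin_def using is_subring_diff[OF P UV(1,2)] by (rule rev_image_eqI) (simp add: UV)
  show "u * v \<in> adjoin A x"
    unfolding adjoin_def using is_subring_mult[OF P UV(1,2)] by (rule rev_image_eqI) (simp add: UV)
qed

lemma base_subset_adjoin: "is_subring A \<Longrightarrow> A \<subseteq> adjoin A x"
  unfolding adjoin_def
  by (auto intro!: image_eqI[where x = "[:a:]" for a] simp: pCons_in_poly_over is_subring_zero)
     (auto simp: poly_over_def is_subring_zero)

lemma in_adjoin: "is_subring A \<Longrightarrow> x \<in> adjoin A x"
  unfolding adjoin_def
  by (auto intro!: image_eqI[where x = "[:0, 1:]"] simp: poly_over_def coeff_pCons
      is_subring_intros split: nat.splits)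

lemma adjoin_subset:
  assumes "is_subring C" "A \<subseteq> C" "x \<in> C"
  shows "adjoin A x \<subseteq> C"
proof -
  have "poly P x \<in> C" if "P \<in> poly_over A" for P
    using that
    by (induction P) (use assms in \<open>auto simp: pCons_in_poly_over is_subring_intros\<close>)
  thus ?thesis unfolding adjoin_def by auto
qed

lemma k_domainI: "is_subfield k \<Longrightarrow> is_subring C \<Longrightarrow> k \<subseteq> C \<Longrightarrow> k_domain k C"
  by unfold_locales

section \<open>Exponential maps as ring homomorphisms\<close>

context exponential_map
begin

lemma D_zero [simp]: "D n 0 = 0"
  using add[OF is_subring_zero[OF subring] is_subring_zero[OF subring], of n]
  by (metis add_0 add_cancel_right_right)

lemma D_minus: "b \<in> B \<Longrightarrow> D n (- b) = - D n b"
  using add[of b "- b" n] subring is_subring_diff[OF subring is_subring_zero[OF subring], of b]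
  by (simp add: eq_neg_iff_add_eq_0 add.commute)

lemma D_diff: "b \<in> B \<Longrightarrow> c \<in> B \<Longrightarrow> D n (b - c) = D n b - D n c"
  using add[of b "- c" n] is_subring_diff[OF subring is_subring_zero[OF subring], of c]
  by (simp add: D_minus)

lemma coeff_exp_poly: "b \<in> B \<Longrightarrow> coeff (exp_poly D b) n = D n b"
  unfolding exp_poly_def using locally_finite[of b]
  by (metis coeff_Abs_poly less_imp_le)

lemma exp_poly_add: "b \<in> B \<Longrightarrow> c \<in> B \<Longrightarrow> exp_poly D (b + c) = exp_poly D b + exp_poly D c"
  by (rule poly_eqI) (simp add: coeff_exp_poly add is_subring_intros[OF subring])

lemma exp_poly_diff: "b \<in> B \<Longrightarrow> c \<in> B \<Longrightarrow> exp_poly D (b - c) = exp_poly D b - exp_poly D c"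
  by (rule poly_eqI) (simp add: coeff_exp_poly D_diff is_subring_intros[OF subring])

lemma exp_poly_mult: "b \<in> B \<Longrightarrow> c \<in> B \<Longrightarrow> exp_poly D (b * c) = exp_poly D b * exp_poly D c"
  by (rule poly_eqI)
     (simp add: coeff_exp_poly leibniz is_subring_intros[OF subring] coeff_mult atMost_atLeast0)

lemma exp_poly_zero [simp]: "exp_poly D 0 = 0"
  by (rule poly_eqI) (simp add: coeff_exp_poly is_subring_intros[OF subring])

lemma exp_poly_eq_0_iff: "b \<in> B \<Longrightarrow> exp_poly D b = 0 \<longleftrightarrow> b = 0"
  by (metis coeff_exp_poly coeff_0 zero exp_poly_zero)

lemma exp_poly_one [simp]: "exp_poly D 1 = 1"
  using exp_poly_mult[of 1 1] exp_poly_eq_0_iff[of 1] is_subring_one[OF subring] by simp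

lemma invariants_iff: "b \<in> invariants B D \<longleftrightarrow> b \<in> B \<and> (\<forall>n>0. D n b = 0)"
proof -
  have "exp_poly D b = [:b:] \<longleftrightarrow> (\<forall>n>0. D n b = 0)" if "b \<in> B"
    using that by (auto simp: poly_eq_iff coeff_exp_poly coeff_pCons zero split: nat.splits)
      (metis gr0_conv_Suc)
  thus ?thesis by (auto simp: invariants_def)
qed

lemma invariants_iff_degree: "b \<in> invariants B D \<longleftrightarrow> b \<in> B \<and> degree (exp_poly D b) = 0"
proof -
  have "degree (exp_poly D b) = 0 \<Longrightarrow> \<forall>n>0. D n b = 0" if "b \<in> B"
    using that by (metis coeff_exp_poly coeff_eq_0)
  moreover have "\<forall>n>0. D n b = 0 \<Longrightarrow> degree (exp_poly D b) = 0" if "b \<in> B"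
    using that degree_le[of 0 "exp_poly D b"] by (simp add: coeff_exp_poly)
  ultimately show ?thesis by (auto simp: invariants_iff)
qed

lemma invariants_subset: "invariants B D \<subseteq> B"
  by (simp add: invariants_def)

lemma exp_poly_invariant: "b \<in> invariants B D \<Longrightarrow> exp_poly D b = [:b:]"
  by (simp add: invariants_def)

lemma D_invariant_mult: "c \<in> invariants B D \<Longrightarrow> b \<in> B \<Longrightarrow> D n (c * b) = c * D n b"
  using exp_poly_mult[of c b] coeff_exp_poly[of "c * b" n]
  by (auto simp: exp_poly_invariant coeff_exp_poly invariants_iff is_subring_intros[OF subring])

lemma base_invariant: "k \<subseteq> invariants B D"
proof
  fix c assume c: "c \<in> k"
  have "D n c = 0" if "n > 0" for n
    using scale[OF c is_subring_one[OF subring], of n] coeff_exp_poly[OF is_subring_one[OF subring], of n] that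
    by simp
  thus "c \<in> invariants B D" using c subset by (auto simp: invariants_iff)
qed

lemma is_subring_invariants: "is_subring (invariants B D)"
  unfolding is_subring_def
  by (auto simp: invariants_def exp_poly_diff exp_poly_mult is_subring_intros[OF subring])

lemma k_domain_invariants: "k_domain k (invariants B D)"
  by (rule k_domainI[OF subfield is_subring_invariants base_invariant])

lemma invariant_cancel:
  assumes "c \<in> invariants B D" "c \<noteq> 0" "b \<in> B" "c * b \<in> invariants B D"
  shows "b \<in> invariants B D"
  using assms by (auto simp: invariants_iff[of b] invariants_iff[of "c * b"] D_invariant_mult)

text \<open>
  On \<open>B\<^sup>\<delta>\<close> the homomorphism \<open>\<delta>\<close> is the inclusion of constants, so it is a substitution on polynomial
  expressions over \<open>B\<^sup>\<delta>\<close>. Degrees of the images can then be read off from \<open>degree_pcompose\<close>.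
\<close>
lemma exp_poly_poly:
  assumes "P \<in> poly_over (invariants B D)" "b \<in> B"
  shows "poly P b \<in> B" and "exp_poly D (poly P b) = pcompose P (exp_poly D b)"
proof -
  have "poly P b \<in> B \<and> exp_poly D (poly P b) = pcompose P (exp_poly D b)"
    using assms(1)
  proof (induction P)
    case (pCons a P)
    thus ?case
      using invariants_subset assms(2)
      by (auto simp: pCons_in_poly_over pcompose_pCons exp_poly_add exp_poly_mult
          exp_poly_invariant is_subring_intros[OF subring] subsetD)
  qed (auto simp: is_subring_intros[OF subring])
  thus "poly P b \<in> B" "exp_poly D (poly P b) = pcompose P (exp_poly D b)" by auto
qed

lemma D_above_degree: "b \<in> B \<Longrightarrow> n > degree (exp_poly D b) \<Longrightarrow> D n b = 0"
  by (metis coeff_exp_poly coeff_eq_0)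

text \<open>If \<open>m\<close> is the degree of \<open>\<delta>(b)\<close>, then \<open>D\<^sub>j (D\<^sub>m b)\<close> is a multiple of \<open>D\<^sub>m\<^sub>+\<^sub>j b = 0\<close>.\<close>
lemma lead_coeff_invariant:
  assumes "b \<in> B"
  shows "lead_coeff (exp_poly D b) \<in> invariants B D"
  using assms by (simp add: coeff_exp_poly invariants_iff closed iterative D_above_degree)

text \<open>
  In positive characteristic \<open>D\<^sub>i\<close> need not lower the degree by exactly \<open>i\<close>; the binomial coefficient
  of the iteration rule decides whether it does.
\<close>
lemma degree_exp_poly_D:
  assumes "b \<in> B" "degree (exp_poly D b) = i + j" "of_nat ((i + j) choose j) \<noteq> (0::'b)" "b \<noteq> 0"
  shows "degree (exp_poly D (D i b)) = j"
proof (rule antisym)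
  have "D (i + j) b \<noteq> 0"
    using assms exp_poly_eq_0_iff[of b] coeff_exp_poly[of b] by (metis leading_coeff_0_iff)
  thus "j \<le> degree (exp_poly D (D i b))"
    using assms by (intro le_degree) (simp add: coeff_exp_poly closed iterative)
  show "degree (exp_poly D (D i b)) \<le> j"
    using assms by (intro degree_le) (simp add: coeff_exp_poly closed iterative D_above_degree)
qed

text \<open>
  By the Leibniz rule, a growth condition on all \<open>D\<^sub>n b\<close> that is compatible with products needs to be
  checked on algebra generators only. With \<open>V\<close> constant this says that \<open>D\<close> preserves a subring;
  with \<open>V n\<close> the elements of degree at most \<open>s n\<close> it bounds the slope of \<open>D\<close>.
\<close>
lemma k_domain_slopes:
  assumes diff: "\<And>n r s. r \<in> V n \<Longrightarrow> s \<in> V n \<Longrightarrow> r - s \<in> V n"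
    and mult: "\<And>i j r s. r \<in> V i \<Longrightarrow> s \<in> V j \<Longrightarrow> r * s \<in> V (i + j)"
    and base: "k \<subseteq> V 0" and V_zero: "\<And>n. 0 \<in> V n"
  shows "k_domain k {b \<in> B. \<forall>n. D n b \<in> V n}"
proof (rule k_domainI[OF subfield])
  have V_sum: "sum g I \<in> V n" if "\<And>i. i \<in> I \<Longrightarrow> g i \<in> V n" for g n and I :: "nat set"
    using that
  proof (induction I rule: infinite_finite_induct)
    case (insert i I)
    hence "g i - (0 - sum g I) \<in> V n" by (intro diff V_zero) auto
    thus ?case using insert by simp
  qed (auto simp: V_zero)
  show k: "k \<subseteq> {b \<in> B. \<forall>n. D n b \<in> V n}"
  proof
    fix c assume c: "c \<in> k"
    have "D n c \<in> V n" for n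
      using c base base_invariant V_zero zero[of c]
      by (cases "n = 0") (auto simp: invariants_iff dest!: subsetD)
    thus "c \<in> {b \<in> B. \<forall>n. D n b \<in> V n}" using c subset by auto
  qed
  show "is_subring {b \<in> B. \<forall>n. D n b \<in> V n}"
    unfolding is_subring_def
  proof (intro conjI ballI)
    have "1 \<in> k" using subfield by (simp add: is_subfield_def is_subring_def)
    thus "1 \<in> {b \<in> B. \<forall>n. D n b \<in> V n}" using k by auto
    fix b c assume b: "b \<in> {b \<in> B. \<forall>n. D n b \<in> V n}" and c: "c \<in> {b \<in> B. \<forall>n. D n b \<in> V n}"
    show "b - c \<in> {b \<in> B. \<forall>n. D n b \<in> V n}"
      using b c by (auto simp: D_diff is_subring_intros[OF subring] intro: diff)
    have "D i b * D (n - i) c \<in> V n" if "i \<in> {0..n}" for i n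
      using mult[of "D i b" i "D (n - i) c" "n - i"] b c that by simp
    thus "b * c \<in> {b \<in> B. \<forall>n. D n b \<in> V n}"
      using b c by (auto simp: leibniz is_subring_intros[OF subring] intro!: V_sum)
  qed
qed

lemma exponential_map_restrict:
  assumes "k_domain k R" "R \<subseteq> B" "\<And>r n. r \<in> R \<Longrightarrow> D n r \<in> R"
  shows "exponential_map k R D"
proof -
  interpret R: k_domain k R by fact
  show ?thesis
    using assms(2,3) by unfold_locales (auto simp: subset_iff add scale zero locally_finite leibniz iterative)
qed

text \<open>For an invariant \<open>c\<close> this is the substitution \<open>t \<mapsto> c t\<close>; it is used to clear denominators.\<close>
lemma exponential_map_rescale:
  assumes c: "c \<in> invariants B D"
  shows "exponential_map k B (\<lambda>n b. c ^ n * D n b)"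
proof -
  have cp: "c ^ n \<in> invariants B D" "c ^ n \<in> B" for n
    using is_subring_power[OF is_subring_invariants c] invariants_subset by auto
  show ?thesis
  proof unfold_locales
    fix x y n i j assume x: "x \<in> B"
    show "c ^ n * D n x \<in> B" using x cp by (auto intro: is_subring_mult[OF subring] closed)
    show "c ^ 0 * D 0 x = x" using x by (simp add: zero)
    show "\<exists>n>0. \<forall>i\<ge>n. c ^ i * D i x = 0" using locally_finite[OF x] by auto
    show "c ^ j * D j (c ^ i * D i x) = of_nat ((i + j) choose j) * (c ^ (i + j) * D (i + j) x)"
      using x by (simp add: D_invariant_mult cp closed iterative power_add)
    { assume y: "y \<in> B"
      show "c ^ n * D n (x + y) = c ^ n * D n x + c ^ n * D n y"
        using x y by (simp add: add distrib_left)
      show "c ^ n * D n (x * y) = (\<Sum>i=0..n. c ^ i * D i x * (c ^ (n - i) * D (n - i) y))"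
        unfolding leibniz[OF x y] sum_distrib_left
      proof (rule sum.cong[OF refl])
        fix i assume "i \<in> {0..n}"
        hence "c ^ n = c ^ i * c ^ (n - i)" by (simp flip: power_add)
        thus "c ^ n * (D i x * D (n - i) y) = c ^ i * D i x * (c ^ (n - i) * D (n - i) y)"
          by simp
      qed }
    { fix a assume a: "a \<in> k"
      show "c ^ n * D n (a * x) = a * (c ^ n * D n x)" using x a by (simp add: scale) }
  qed
qed

lemma uniformly_locally_finite:
  assumes "finite S" "S \<subseteq> B"
  obtains N where "\<And>b n. b \<in> S \<Longrightarrow> n \<ge> N \<Longrightarrow> D n b = 0"
proof -
  have "\<exists>N. \<forall>b\<in>S. \<forall>n\<ge>N. D n b = 0"
    using assms
  proof (induction S)
    case (insert b S)
    then obtain N where "\<forall>b\<in>S. \<forall>n\<ge>N. D n b = 0" by auto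
    moreover obtain M where "\<forall>n\<ge>M. D n b = 0" using locally_finite[of b] insert by auto
    ultimately have "\<forall>b\<in>insert b S. \<forall>n\<ge>max M N. D n b = 0" by auto
    thus ?case by blast
  qed auto
  thus thesis using that by blast
qed

section \<open>Local slices\<close>

text \<open>
  A characteristic-free substitute for Lucas' theorem. Minimality of the degree \<open>d\<close> of the slice makes the inner binomial coefficients of
  \<open>d\<close> vanish, so \<open>(1 + T)\<^sup>m\<^sup>d\<^sup>+\<^sup>r = (1 + T\<^sup>d)\<^sup>m (1 + T)\<^sup>r\<close>, where \<open>T\<^sup>r\<close> has coefficient \<open>1\<close>.
\<close>
lemma local_slice_choose:
  assumes "local_slice B D x" "r < degree (exp_poly D x)"
  shows "of_nat ((m * degree (exp_poly D x) + r) choose r) = (1::'b)"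
proof -
  define d where "d = degree (exp_poly D x)"
  have x: "x \<in> B" "d > 0" "x \<noteq> 0"
    and min: "\<And>b. b \<in> B \<Longrightarrow> degree (exp_poly D b) > 0 \<Longrightarrow> d \<le> degree (exp_poly D b)"
    using assms by (auto simp: local_slice_def d_def)
  have mid: "of_nat (d choose i) = (0::'b)" if i: "0 < i" "i < d" for i
  proof (rule ccontr)
    assume "of_nat (d choose i) \<noteq> (0::'b)"
    hence "degree (exp_poly D (D (d - i) x)) = i"
      using degree_exp_poly_D[of x "d - i" i] i x by (simp add: d_def)
    thus False using min[of "D (d - i) x"] i x closed by simp
  qed
  have frob: "[:1, 1:] ^ d = (1 + monom 1 d :: 'b poly)"
  proof (rule poly_eqI)
    fix i
    have "coeff ([:1, 1:] ^ d :: 'b poly) i = of_nat (d choose i)"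
      by (cases "i \<le> d") (auto simp: coeff_linear_poly_power coeff_eq_0 degree_linear_power binomial_eq_0)
    thus "coeff ([:1, 1:] ^ d) i = coeff (1 + monom 1 d :: 'b poly) i"
      using mid[of i] x(2) by (cases "i = 0"; cases "i = d"; cases "i < d") (auto simp: coeff_1 gr0_conv_Suc binomial_eq_0)
  qed
  have "coeff (([:1, 1:] ^ d) ^ m * Q) r = coeff (Q :: 'b poly) r" for Q
    unfolding frob
  proof (induction m)
    case (Suc m)
    have "(1 + monom 1 d) ^ Suc m * Q = (1 + monom 1 d) ^ m * Q + monom 1 d * ((1 + monom 1 d) ^ m * Q)"
      by (simp add: algebra_simps)
    thus ?case using Suc assms(2) by (simp only: coeff_add) (simp add: coeff_monom_mult d_def)
  qed simp
  from this[of "[:1, 1:] ^ r"] show ?thesis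
    by (simp add: coeff_linear_poly_power power_mult[symmetric] power_add[symmetric] d_def
        mult.commute add.commute)
qed

text \<open>
  If the degree were \<open>m d + r\<close> with \<open>0 < r < d\<close>, then \<open>D\<^sub>m\<^sub>d b\<close> would have degree \<open>r\<close>, contradicting the
  minimality of \<open>d\<close>.
\<close>
lemma local_slice_degree_dvd:
  assumes "local_slice B D x" "b \<in> B"
  shows "degree (exp_poly D x) dvd degree (exp_poly D b)"
proof (rule ccontr)
  assume ndvd: "\<not> degree (exp_poly D x) dvd degree (exp_poly D b)"
  define d n where "d = degree (exp_poly D x)" and "n = degree (exp_poly D b)"
  define m r where "m = n div d" and "r = n mod d"
  have d: "d > 0" and min: "\<And>b. b \<in> B \<Longrightarrow> degree (exp_poly D b) > 0 \<Longrightarrow> d \<le> degree (exp_poly D b)"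
    using assms by (auto simp: local_slice_def d_def)
  have r: "0 < r" "r < d" and n: "n = m * d + r" and "b \<noteq> 0"
    using ndvd d by (auto simp: r_def m_def n_def d_def mod_greater_zero_iff_not_dvd)
  have "degree (exp_poly D (D (m * d) b)) = r"
    using degree_exp_poly_D[of b "m * d" r] local_slice_choose[OF assms(1), of r m] r n assms(2) \<open>b \<noteq> 0\<close>
    by (simp add: n_def d_def)
  thus False using min[of "D (m * d) b"] r closed assms(2) by simp
qed

lemma local_slice_transcendental:
  assumes "local_slice B D x" "P \<in> poly_over (invariants B D)" "poly P x = 0"
  shows "P = 0"
  using assms exp_poly_poly[of P x] by (auto simp: local_slice_def dest: pcompose_eq_0)

text \<open>
  Division with remainder for \<open>\<delta>(b)\<close> by \<open>\<delta>(x)\<close>: if the former has degree \<open>d m\<close> and leading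
  coefficient \<open>c\<close>, then \<open>f\<^sup>m b - c x\<^sup>m\<close> has smaller degree.
\<close>
lemma local_slice_generates:
  assumes "local_slice B D x" "b \<in> B"
  shows "\<exists>M. lead_coeff (exp_poly D x) ^ M * b \<in> adjoin (invariants B D) x"
  using assms(2)
proof (induction "degree (exp_poly D b)" arbitrary: b rule: less_induct)
  case less
  let ?A = "invariants B D"
  define d f where "d = degree (exp_poly D x)" and "f = lead_coeff (exp_poly D x)"
  have x: "x \<in> B" "d > 0" using assms(1) by (auto simp: local_slice_def d_def)
  have f: "f \<in> ?A" "f \<noteq> 0"
    using lead_coeff_invariant[OF x(1)] x(2) by (auto simp: f_def d_def)
  note R = is_subring_adjoin[OF is_subring_invariants, of x]
  note AR = base_subset_adjoin[OF is_subring_invariants, of x]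
  have fp: "f ^ i \<in> ?A" "f ^ i \<in> B" for i
    using is_subring_power[OF is_subring_invariants f(1)] invariants_subset by auto
  obtain m where m: "degree (exp_poly D b) = d * m"
    using local_slice_degree_dvd[OF assms(1) less.prems] by (auto simp: d_def)
  show ?case
  proof (cases "m = 0")
    case True
    hence "b \<in> ?A" using m less.prems by (simp add: invariants_iff_degree)
    thus ?thesis using AR by (intro exI[of _ 0]) auto
  next
    case False
    define c where "c = lead_coeff (exp_poly D b)"
    have c: "c \<in> ?A" using lead_coeff_invariant[OF less.prems] by (simp add: c_def)
    have xm: "x ^ m \<in> B" and xmR: "x ^ m \<in> adjoin ?A x"
      using is_subring_power[OF subring x(1)] is_subring_power[OF R in_adjoin[OF is_subring_invariants]] by auto
    have exm: "exp_poly D (x ^ m) = exp_poly D x ^ m"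
      by (induction m) (auto simp: exp_poly_mult x is_subring_power[OF subring])
    define b' where "b' = f ^ m * b - c * x ^ m"
    have cB: "c \<in> B" using c invariants_subset by auto
    have b': "b' \<in> B" unfolding b'_def
      using fp cB xm less.prems by (simp add: is_subring_intros[OF subring])
    have eb': "exp_poly D b' = smult (f ^ m) (exp_poly D b) - smult c (exp_poly D x ^ m)"
      unfolding b'_def using fp cB c xm less.prems
      by (simp add: is_subring_intros[OF subring] exp_poly_diff exp_poly_mult exp_poly_invariant exm)
    have "degree (exp_poly D b') < d * m"
    proof -
      have "degree (exp_poly D b') \<le> d * m"
        unfolding eb' by (intro degree_diff_le order.trans[OF degree_smult_le])
          (auto simp: m degree_power_eq d_def degree_power_le)
      moreover have "coeff (exp_poly D b') (d * m) = 0"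
      proof -
        have "coeff (exp_poly D x ^ m) (d * m) = f ^ m"
          using lead_coeff_power[of "exp_poly D x" m] degree_power_eq[of "exp_poly D x" m] x(2)
          by (metis d_def degree_0 f_def less_irrefl mult.commute)
        thus ?thesis unfolding eb' by (simp add: c_def m)
      qed
      ultimately show ?thesis
        using x(2) False
        by (metis degree_0 le_neq_implies_less leading_coeff_0_iff mult_pos_pos gr0I)
    qed
    then obtain M where "f ^ M * b' \<in> adjoin ?A x"
      using less.hyps[of b'] b' m by (auto simp: f_def)
    moreover have "f ^ M * (c * x ^ m) \<in> adjoin ?A x"
      using fp c AR xmR by (auto intro!: is_subring_mult[OF R])
    ultimately have "f ^ M * b' + f ^ M * (c * x ^ m) \<in> adjoin ?A x"
      by (rule is_subring_add[OF R])
    also have "f ^ M * b' + f ^ M * (c * x ^ m) = f ^ (M + m) * b"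
      by (simp add: b'_def algebra_simps power_add)
    finally show ?thesis unfolding f_def by blast
  qed
qed

end

text \<open>
  An invariant \<open>b\<close> of \<open>\<gamma>\<close> outside \<open>B\<^sup>\<delta>\<close> would make \<open>f\<^sup>M b = P(x)\<close> invariant for some non-constant
  polynomial \<open>P\<close> over invariants of \<open>\<gamma>\<close>. Then \<open>x\<close> would be \<open>\<gamma>\<close>-invariant as well, hence \<open>A[x]\<close>, hence
  all of \<open>B\<close>, and \<open>\<gamma>\<close> would be trivial.
\<close>
lemma invariants_subset_imp_eq:
  assumes \<delta>: "exponential_map k B \<delta>" and \<gamma>: "exponential_map k B \<gamma>" "nontrivial_exp B \<gamma>"
    and x: "local_slice B \<delta> x" and sub: "invariants B \<delta> \<subseteq> invariants B \<gamma>"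
  shows "invariants B \<gamma> = invariants B \<delta>"
proof (rule ccontr)
  assume ne: "invariants B \<gamma> \<noteq> invariants B \<delta>"
  interpret d: exponential_map k B \<delta> by fact
  interpret g: exponential_map k B \<gamma> by fact
  define f where "f = lead_coeff (exp_poly \<delta> x)"
  have xB: "x \<in> B" and "degree (exp_poly \<delta> x) > 0" using x by (auto simp: local_slice_def)
  hence f: "f \<in> invariants B \<delta>" "f \<noteq> 0" unfolding f_def using d.lead_coeff_invariant by auto
  have fp: "f ^ M \<in> invariants B \<delta>" for M
    using is_subring_power[OF d.is_subring_invariants f(1)] .
  from ne sub obtain b where b: "b \<in> invariants B \<gamma>" "b \<notin> invariants B \<delta>" by auto
  obtain M P where MP: "f ^ M * b = poly P x" "P \<in> poly_over (invariants B \<delta>)"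
    using d.local_slice_generates[OF x, of b] b(1) unfolding invariants_def[of B \<gamma>] adjoin_def f_def by blast
  have bB: "b \<in> B" using b by (simp add: invariants_def)
  have "degree P \<noteq> 0"
  proof
    assume "degree P = 0"
    then obtain a where "P = [:a:]" by (metis degree_eq_zeroE)
    hence "f ^ M * b \<in> invariants B \<delta>" using MP by (simp add: pCons_in_poly_over)
    thus False using d.invariant_cancel[OF fp _ bB] f b by auto
  qed
  moreover have P: "P \<in> poly_over (invariants B \<gamma>)" using MP sub by (auto simp: poly_over_def)
  have "poly P x \<in> invariants B \<gamma>"
    unfolding MP(1)[symmetric] using fp sub b(1) by (intro is_subring_mult[OF g.is_subring_invariants]) auto
  hence "degree P * degree (exp_poly \<gamma> x) = 0"
    using g.exp_poly_poly(2)[OF P xB] by (simp add: g.invariants_iff_degree degree_pcompose)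
  ultimately have "x \<in> invariants B \<gamma>" using xB by (simp add: g.invariants_iff_degree)
  hence "adjoin (invariants B \<delta>) x \<subseteq> invariants B \<gamma>"
    using adjoin_subset[OF g.is_subring_invariants sub] by simp
  hence "c \<in> invariants B \<gamma>" if "c \<in> B" for c
    using d.local_slice_generates[OF x that] g.invariant_cancel[of "f ^ _" c] fp sub f(2) that
    by (metis f_def power_not_zero subsetD)
  thus False using \<gamma>(2) g.invariants_subset by (auto simp: nontrivial_exp_def)
qed

section \<open>Weighted degrees in a polynomial ring\<close>

locale polynomial_extension =
  fixes A :: "'b::idom set" and x :: 'b
  assumes base_subring: "is_subring A"
    and transcendental: "P \<in> poly_over A \<Longrightarrow> poly P x = 0 \<Longrightarrow> P = 0"
begin

definition expansion :: "'b \<Rightarrow> 'b poly" where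
  "expansion r = (THE P. P \<in> poly_over A \<and> poly P x = r)"

text \<open>
  The expansion of an element of \<open>A[x]\<close> when \<open>x\<close> is given weight \<open>q\<close>. The weight turns a slope
  \<open>p/q\<close> with respect to the degree in \<open>x\<close> into the integral slope \<open>p\<close>.
\<close>
definition weighted :: "nat \<Rightarrow> 'b \<Rightarrow> 'b poly" where
  "weighted q r = pcompose (expansion r) (monom 1 q)"

lemma expansion_poly: "P \<in> poly_over A \<Longrightarrow> expansion (poly P x) = P"
  unfolding expansion_def
proof (rule the_equality)
  fix Q assume P: "P \<in> poly_over A" and Q: "Q \<in> poly_over A \<and> poly Q x = poly P x"
  have "Q - P \<in> poly_over A" using P Q by (auto intro: is_subring_diff[OF is_subring_poly_over[OF base_subring]])
  moreover have "poly (Q - P) x = 0" using Q by simp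
  ultimately show "Q = P" using transcendental by force
qed simp

lemma weighted_poly: "P \<in> poly_over A \<Longrightarrow> weighted q (poly P x) = pcompose P (monom 1 q)"
  by (simp add: weighted_def expansion_poly)

lemma adjoin_cases:
  assumes "r \<in> adjoin A x"
  obtains P where "P \<in> poly_over A" "r = poly P x"
  using assms by (auto simp: adjoin_def)

lemmas adjoin_subring = is_subring_adjoin[OF base_subring, of x]
lemmas adjoin_intros = is_subring_intros[OF adjoin_subring]
lemmas base_adjoin = subsetD[OF base_subset_adjoin[OF base_subring, of x]]
lemmas gen_adjoin = in_adjoin[OF base_subring, of x]
lemmas poly_over_intros = is_subring_intros[OF is_subring_poly_over[OF base_subring]]

lemma weighted_add:
  "r \<in> adjoin A x \<Longrightarrow> s \<in> adjoin A x \<Longrightarrow> weighted q (r + s) = weighted q r + weighted q s"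
  using weighted_poly poly_over_intros
  by (elim adjoin_cases) (simp flip: poly_add add: pcompose_add)

lemma weighted_mult:
  "r \<in> adjoin A x \<Longrightarrow> s \<in> adjoin A x \<Longrightarrow> weighted q (r * s) = weighted q r * weighted q s"
  using weighted_poly poly_over_intros
  by (elim adjoin_cases) (simp flip: poly_mult add: pcompose_mult)

lemma weighted_base: "a \<in> A \<Longrightarrow> weighted q a = [:a:]"
  using weighted_poly[of "[:a:]" q] poly_over_intros(2) by (simp add: pCons_in_poly_over)

lemma weighted_zero [simp]: "weighted q 0 = 0"
  using weighted_poly[of 0 q] poly_over_intros(2) by simp

lemma weighted_gen: "weighted q x = monom 1 q"
proof -
  have "[:0, 1:] \<in> poly_over A"
    using is_subring_intros[OF base_subring] poly_over_intros(2) by (simp add: pCons_in_poly_over)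
  from weighted_poly[OF this, of q] show ?thesis by (simp add: pcompose_pCons)
qed

lemma coeff_weighted:
  assumes "r \<in> adjoin A x"
  shows "coeff (weighted q r) m \<in> A"
proof -
  obtain P where P: "P \<in> poly_over A" "r = poly P x" using assms by (rule adjoin_cases)
  have "pcompose P (monom 1 q) \<in> poly_over A"
    using P(1)
  proof (induction P)
    case (pCons a P)
    have "monom 1 q \<in> poly_over A"
      using is_subring_intros[OF base_subring] by (auto simp: poly_over_def)
    thus ?case using pCons poly_over_intros
      by (simp add: pcompose_pCons pCons_in_poly_over)
  qed (use poly_over_intros in auto)
  thus ?thesis using P by (simp add: weighted_poly poly_over_def)
qed

lemma weighted_degree: "degree (weighted q r) = degree (expansion r) * q"
  by (simp add: weighted_def degree_pcompose degree_monom_eq)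

lemma expansion_eq_0_iff:
  assumes "r \<in> adjoin A x"
  shows "expansion r = 0 \<longleftrightarrow> r = 0"
  using assms expansion_poly poly_over_intros(2)
  by (elim adjoin_cases) (metis poly_0)

lemma weighted_eq_0_iff: "q > 0 \<Longrightarrow> r \<in> adjoin A x \<Longrightarrow> weighted q r = 0 \<longleftrightarrow> r = 0"
  by (simp add: weighted_def pcompose_eq_0_iff degree_monom_eq expansion_eq_0_iff)

definition filt :: "nat \<Rightarrow> nat \<Rightarrow> 'b set" where
  "filt q m = {r \<in> adjoin A x. degree (weighted q r) \<le> m}"

lemma filt_add: "r \<in> filt q m \<Longrightarrow> s \<in> filt q m \<Longrightarrow> r + s \<in> filt q m"
  by (auto simp: filt_def adjoin_intros weighted_add degree_add_le)

lemma filt_mult: "r \<in> filt q m \<Longrightarrow> s \<in> filt q l \<Longrightarrow> r * s \<in> filt q (m + l)"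
  by (auto simp: filt_def adjoin_intros weighted_mult intro: order.trans[OF degree_mult_le])

lemma filt_mono: "r \<in> filt q m \<Longrightarrow> m \<le> l \<Longrightarrow> r \<in> filt q l"
  by (auto simp: filt_def)

lemma filt_zero [simp]: "0 \<in> filt q m"
  by (simp add: filt_def adjoin_intros)

lemma filt_sum: "(\<And>i. i \<in> I \<Longrightarrow> g i \<in> filt q m) \<Longrightarrow> sum g I \<in> filt q m"
  by (induction I rule: infinite_finite_induct) (auto simp: filt_add)

lemma filt_base: "a \<in> A \<Longrightarrow> a \<in> filt q m"
  by (simp add: filt_def weighted_base base_adjoin)

lemma filt_gen: "x \<in> filt q q"
  by (simp add: filt_def weighted_gen gen_adjoin degree_monom_eq)

lemma filt_coeff_eq_0: "r \<in> filt q m \<Longrightarrow> m < l \<Longrightarrow> coeff (weighted q r) l = 0"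
  by (simp add: filt_def coeff_eq_0)

lemma coeff_weighted_mult:
  assumes "r \<in> filt q m" "s \<in> filt q l"
  shows "coeff (weighted q (r * s)) (m + l) = coeff (weighted q r) m * coeff (weighted q s) l"
proof -
  have top: "coeff (P * Q) (m + l) = coeff P m * coeff Q l"
    if "degree P \<le> m" "degree Q \<le> l" for P Q :: "'b poly"
  proof -
    have "(\<Sum>i\<le>m + l. coeff P i * coeff Q (m + l - i)) = (\<Sum>i\<in>{m}. coeff P i * coeff Q (m + l - i))"
    proof (rule sum.mono_neutral_right)
      show "\<forall>i\<in>{..m + l} - {m}. coeff P i * coeff Q (m + l - i) = 0"
      proof
        fix i assume "i \<in> {..m + l} - {m}"
        hence "i > m \<or> m + l - i > l" by auto
        thus "coeff P i * coeff Q (m + l - i) = 0"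
          using that by (auto simp: coeff_eq_0)
      qed
    qed auto
    thus ?thesis by (simp add: coeff_mult)
  qed
  show ?thesis using assms by (simp add: filt_def weighted_mult top)
qed

text \<open>
  Horner's scheme as an induction principle that keeps track of the weighted degree.
\<close>
lemma filt_induct [consumes 2, case_names base step]:
  assumes "q > 0" "r \<in> filt q m"
    and base: "\<And>m a. a \<in> A \<Longrightarrow> Q m a"
    and step: "\<And>m a r. a \<in> A \<Longrightarrow> r \<in> filt q m \<Longrightarrow> Q m r \<Longrightarrow> Q (q + m) (a + x * r)"
  shows "Q m r"
proof -
  have "Q m (poly P x)" if "P \<in> poly_over A" "degree P * q \<le> m" for P
    using that
  proof (induction P arbitrary: m)
    case 0
    show ?case using base[of 0 m] is_subring_zero[OF base_subring] by simp
  next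
    case (pCons a P)
    show ?case
    proof (cases "P = 0")
      case True
      thus ?thesis using base[of a m] pCons.prems by (simp add: pCons_in_poly_over)
    next
      case False
      hence m: "q + degree P * q \<le> m" using pCons.prems by simp
      have P: "P \<in> poly_over A" "a \<in> A" using pCons.prems by (auto simp: pCons_in_poly_over)
      have "degree P * q \<le> m - q" using m by simp
      moreover from this have "poly P x \<in> filt q (m - q)"
        using P by (simp add: filt_def adjoin_def weighted_degree expansion_poly)
      ultimately have "Q (q + (m - q)) (a + x * poly P x)"
        using P pCons.IH by (intro step) auto
      thus ?thesis using m by simp
    qed
  qed
  thus ?thesis using assms(2)
    by (auto simp: filt_def weighted_degree expansion_poly adjoin_def)
qed

end

section \<open>The leading form of an exponential map\<close>

locale slope_bounded = polynomial_extension A x + exponential_map k "adjoin A x" D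
  for A :: "'b::idom set" and x k D +
  fixes p q :: nat
  assumes base_k_domain: "k_domain k A"
    and q_pos: "q > 0"
    and slope_base: "a \<in> A \<Longrightarrow> D n a \<in> filt q (p * n)"
    and slope_gen: "D n x \<in> filt q (q + p * n)"
begin

abbreviation w where "w \<equiv> weighted q"
abbreviation F where "F \<equiv> filt q"

lemma slope: "r \<in> F m \<Longrightarrow> D n r \<in> F (m + p * n)"
  using q_pos
proof (induction m r arbitrary: n rule: filt_induct)
  case (base m a)
  thus ?case using filt_mono[OF slope_base[of a n], of "m + p * n"] by simp
next
  case (step m a r)
  have "r \<in> adjoin A x" using step by (simp add: filt_def)
  moreover have "(\<Sum>i=0..n. D i x * D (n - i) r) \<in> F (q + m + p * n)"
  proof (rule filt_sum)
    fix i assume "i \<in> {0..n}"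
    hence "q + p * i + (m + p * (n - i)) = q + m + p * n"
      by (simp flip: distrib_left)
    thus "D i x * D (n - i) r \<in> F (q + m + p * n)"
      using filt_mult[OF slope_gen step.IH, of i "n - i"] by (simp only:)
  qed
  moreover have "D n a \<in> F (q + m + p * n)"
    using slope_base[OF step(1)] by (rule filt_mono) simp
  ultimately show ?case
    using step(1) by (simp add: add leibniz adjoin_intros gen_adjoin base_adjoin filt_add)
qed

text \<open>
  If \<open>r\<close> has weighted degree \<open>m\<close> and leading term \<open>c x\<^sup>m\<^sup>/\<^sup>q\<close>, then this is the image of \<open>c x\<^sup>m\<^sup>/\<^sup>q\<close> under
  the homogeneous exponential map attached to \<open>D\<close>, with \<open>x\<close> set to \<open>1\<close>. The degree \<open>m\<close> is an argument
  because \<open>r \<mapsto> lead_form m r\<close> is additive only for fixed \<open>m\<close>.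
\<close>
definition lead_form :: "nat \<Rightarrow> 'b \<Rightarrow> 'b poly" where
  "lead_form m r = Abs_poly (\<lambda>n. coeff (w (D n r)) (m + p * n))"

lemma coeff_lead_form:
  assumes "r \<in> adjoin A x"
  shows "coeff (lead_form m r) n = coeff (w (D n r)) (m + p * n)"
proof -
  obtain N where "\<forall>i\<ge>N. D i r = 0" using locally_finite[OF assms] by auto
  hence "\<And>i. N < i \<Longrightarrow> coeff (w (D i r)) (m + p * i) = 0" by simp
  thus ?thesis unfolding lead_form_def by (subst coeff_Abs_poly) auto
qed

lemma filt_adjoin: "r \<in> F m \<Longrightarrow> r \<in> adjoin A x"
  by (simp add: filt_def)

lemma lead_form_add:
  assumes "r \<in> adjoin A x" "s \<in> adjoin A x"
  shows "lead_form m (r + s) = lead_form m r + lead_form m s"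
  using assms by (intro poly_eqI) (simp add: coeff_lead_form add weighted_add closed adjoin_intros)

lemma w_sum: "(\<And>i. i \<in> I \<Longrightarrow> g i \<in> adjoin A x) \<Longrightarrow> w (sum g I) = (\<Sum>i\<in>I. w (g i))"
  by (induction I rule: infinite_finite_induct) (auto simp: weighted_add adjoin_intros)

lemma lead_form_mult:
  assumes "r \<in> F m" "s \<in> F l"
  shows "lead_form (m + l) (r * s) = lead_form m r * lead_form l s"
proof (rule poly_eqI)
  fix n
  note R = assms[THEN filt_adjoin]
  have "coeff (lead_form (m + l) (r * s)) n
      = (\<Sum>i=0..n. coeff (w (D i r * D (n - i) s)) (m + l + p * n))"
    using R by (simp add: coeff_lead_form leibniz adjoin_intros closed w_sum coeff_sum)
  also have "\<dots> = (\<Sum>i=0..n. coeff (lead_form m r) i * coeff (lead_form l s) (n - i))"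
  proof (rule sum.cong[OF refl])
    fix i assume "i \<in> {0..n}"
    hence e: "m + l + p * n = (m + p * i) + (l + p * (n - i))"
      by (simp flip: distrib_left)
    show "coeff (w (D i r * D (n - i) s)) (m + l + p * n)
        = coeff (lead_form m r) i * coeff (lead_form l s) (n - i)"
      unfolding e
      using R coeff_weighted_mult[OF slope[OF assms(1), of i] slope[OF assms(2), of "n - i"]]
      by (simp add: coeff_lead_form)
  qed
  finally show "coeff (lead_form (m + l) (r * s)) n = coeff (lead_form m r * lead_form l s) n"
    by (simp add: coeff_mult atMost_atLeast0)
qed

lemma lead_form_below: "r \<in> F l \<Longrightarrow> l < m \<Longrightarrow> lead_form m r = 0"
  by (intro poly_eqI) (simp add: coeff_lead_form filt_adjoin filt_coeff_eq_0[OF slope])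

lemma lead_form_zero [simp]: "lead_form m 0 = 0"
  by (intro poly_eqI) (simp add: coeff_lead_form adjoin_intros)

text \<open>
  The leading form depends on the leading term only. When \<open>q\<close> does not divide \<open>m\<close>, both sides are zero,
  since weighted degrees are multiples of \<open>q\<close>.
\<close>
lemma lead_form_eq:
  assumes "r \<in> F m"
  shows "lead_form m r = lead_form 0 (coeff (w r) m) * lead_form q x ^ (m div q)"
  using q_pos assms
proof (induction m r rule: filt_induct)
  case (base m a)
  thus ?case
    using lead_form_below[OF filt_base[of a q 0], of m]
    by (cases "m = 0") (auto simp: weighted_base coeff_eq_0)
next
  case (step m a r)
  note R = filt_adjoin[OF step(2)]
  have "lead_form (q + m) (a + x * r) = lead_form (q + m) a + lead_form (q + m) (x * r)"
    using step R by (simp add: lead_form_add adjoin_intros base_adjoin gen_adjoin)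
  also have "lead_form (q + m) a = 0"
    using lead_form_below[OF filt_base[of a q 0]] step q_pos by simp
  also have "lead_form (q + m) (x * r) = lead_form q x * lead_form m r"
    by (rule lead_form_mult[OF filt_gen step(2)])
  finally have "lead_form (q + m) (a + x * r) = lead_form q x * lead_form m r" by simp
  moreover have "coeff (w (a + x * r)) (q + m) = coeff (w r) m"
    using step R q_pos
    by (simp add: weighted_add weighted_mult adjoin_intros base_adjoin gen_adjoin weighted_base
        weighted_gen coeff_monom_mult coeff_eq_0)
  ultimately show ?case using step.IH q_pos by (simp add: mult_ac)
qed

text \<open>
  The iteration rule for leading forms; \<open>m + p i\<close> is the degree at which \<open>D\<^sub>i r\<close> is expected when \<open>r\<close>
  has degree \<open>m\<close>.
\<close>
lemma coeff_lead_form_D: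
  assumes "r \<in> adjoin A x"
  shows "coeff (lead_form (m + p * i) (D i r)) j = of_nat ((i + j) choose j) * coeff (lead_form m r) (i + j)"
proof -
  have "w (of_nat c * s) = of_nat c * w s" if "s \<in> adjoin A x" for c s
    using that
    by (induction c)
      (auto simp: weighted_add adjoin_intros distrib_right is_subring_of_nat[OF adjoin_subring])
  thus ?thesis
    using assms by (simp add: coeff_lead_form closed iterative distrib_left add_ac of_nat_poly)
qed

text \<open>
  If the leading form of \<open>x\<close> had degree \<open>m > 0\<close>, then, by the iteration rule, that of \<open>D\<^sub>m x\<close> would be
  constant. But it is also a non-zero multiple of the \<open>l\<close>-th power of the leading form of \<open>x\<close>, with
  \<open>l = (q + p m) / q \<ge> 1\<close>. The last inequality is where the slope has to be non-negative.
\<close>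
lemma lead_form_gen: "lead_form q x = 1"
proof (rule ccontr)
  define m where "m = degree (lead_form q x)"
  have c0: "coeff (lead_form q x) 0 = 1"
    by (simp add: coeff_lead_form gen_adjoin zero weighted_gen)
  assume "lead_form q x \<noteq> 1"
  have "m > 0"
  proof (rule ccontr)
    assume "\<not> m > 0"
    then obtain c where "lead_form q x = [:c:]" by (metis degree_eq_zeroE m_def gr0I)
    with c0 \<open>lead_form q x \<noteq> 1\<close> show False by (simp add: one_pCons)
  qed
  define c where "c = coeff (w (D m x)) (q + p * m)"
  have DF: "D m x \<in> F (q + p * m)" by (rule slope_gen)
  have "c = lead_coeff (lead_form q x)"
    by (simp add: c_def coeff_lead_form gen_adjoin m_def)
  hence "c \<noteq> 0" using \<open>m > 0\<close> by (auto simp: m_def)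
  have cA: "c \<in> A" unfolding c_def by (intro coeff_weighted closed gen_adjoin)
  have "lead_form (q + p * m) (D m x) = lead_form 0 c * lead_form q x ^ ((q + p * m) div q)"
    unfolding c_def by (rule lead_form_eq[OF DF])
  moreover have "lead_form 0 c \<noteq> 0"
    using coeff_lead_form[of c 0 0] cA \<open>c \<noteq> 0\<close> by (auto simp: base_adjoin zero weighted_base)
  moreover have "lead_form q x \<noteq> 0" using c0 by auto
  ultimately have "degree (lead_form (q + p * m) (D m x))
      = degree (lead_form 0 c) + ((q + p * m) div q) * m"
    by (simp add: degree_mult_eq degree_power_eq m_def)
  moreover have "(q + p * m) div q > 0" using q_pos by (simp add: div_greater_zero_iff)
  moreover have "degree (lead_form (q + p * m) (D m x)) \<le> 0"
    by (rule degree_le) (simp add: coeff_lead_form_D gen_adjoin coeff_eq_0 m_def)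
  ultimately show False using \<open>m > 0\<close> by simp
qed

definition induced :: "nat \<Rightarrow> 'b \<Rightarrow> 'b" where
  "induced n a = coeff (w (D n a)) (p * n)"

text \<open>As \<open>x\<close> contributes only factors \<open>1\<close>, it disappears from \<open>lead_form_eq\<close>.\<close>
lemma lead_form_D:
  assumes "a \<in> A"
  shows "lead_form (p * i) (D i a) = lead_form 0 (induced i a)"
  using lead_form_eq[OF slope_base[OF assms, of i]] by (simp add: lead_form_gen induced_def)

lemma induced_eq: "a \<in> A \<Longrightarrow> induced n a = coeff (lead_form 0 a) n"
  by (simp add: induced_def coeff_lead_form base_adjoin)

lemma exponential_map_induced: "exponential_map k A induced"
proof -
  interpret base: k_domain k A by (rule base_k_domain)
  have kA: "c \<in> k \<Longrightarrow> c \<in> A" for c using base.subset by auto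
  note A = is_subring_intros[OF base_subring]
  show ?thesis
  proof unfold_locales
    fix a b c n i j
    assume a: "a \<in> A"
    show ind_closed: "induced n a \<in> A" for n
      unfolding induced_def using a by (intro coeff_weighted closed base_adjoin)
    show "induced 0 a = a" using a by (simp add: induced_def zero base_adjoin weighted_base)
    show "\<exists>n>0. \<forall>i\<ge>n. induced i a = 0"
      using locally_finite[OF base_adjoin[OF a]] by (auto simp: induced_def)
    show "induced j (induced i a) = of_nat ((i + j) choose j) * induced (i + j) a"
      using coeff_lead_form_D[OF base_adjoin[OF a], of 0 i j] induced_eq[OF ind_closed, of j i]
      by (simp add: lead_form_D[OF a] induced_eq[OF a, of "i + j"])
    { assume b: "b \<in> A"
      show "induced n (a + b) = induced n a + induced n b"
        using a b A by (simp add: induced_eq lead_form_add base_adjoin)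
      show "induced n (a * b) = (\<Sum>i=0..n. induced i a * induced (n - i) b)"
        using a b A lead_form_mult[OF filt_base filt_base, of a b 0 0]
        by (simp add: induced_eq coeff_mult atMost_atLeast0) }
    { assume c: "c \<in> k"
      show "induced n (c * a) = c * induced n a"
        using a c kA[OF c] scale[OF c base_adjoin[OF a]] closed[OF base_adjoin[OF a]]
        by (simp add: induced_def weighted_mult base_adjoin weighted_base) }
  qed
qed

lemma induced_nontrivial:
  assumes "n > 0"
    and "(\<exists>a\<in>A. D n a \<noteq> 0 \<and> degree (w (D n a)) = p * n) \<or>
      (D n x \<noteq> 0 \<and> degree (w (D n x)) = q + p * n)"
  shows "nontrivial_exp A induced"
  using assms(2)
proof
  interpret E: exponential_map k A induced by (rule exponential_map_induced)
  assume "\<exists>a\<in>A. D n a \<noteq> 0 \<and> degree (w (D n a)) = p * n"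
  then obtain a where a: "a \<in> A" "D n a \<noteq> 0" "degree (w (D n a)) = p * n" by auto
  hence "induced n a \<noteq> 0"
    using weighted_eq_0_iff[OF q_pos closed[OF base_adjoin[OF a(1)]], of n]
    by (simp add: induced_def flip: a(3))
  hence "a \<notin> invariants A induced" using assms(1) by (auto simp: E.invariants_iff)
  thus ?thesis using a(1) by (auto simp: nontrivial_exp_def)
next
  assume x: "D n x \<noteq> 0 \<and> degree (w (D n x)) = q + p * n"
  hence "coeff (lead_form q x) n \<noteq> 0"
    using weighted_eq_0_iff[OF q_pos closed[OF gen_adjoin], of n]
    by (simp add: coeff_lead_form gen_adjoin flip: conjunct2[OF x])
  thus ?thesis using assms(1) by (simp add: lead_form_gen coeff_1)
qed

end

section \<open>From the polynomial ring to its coefficient ring\<close>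

lemma hull_generators_subset:
  assumes "A = k_domain k hull S" "S \<subseteq> C" "k_domain k C"
  shows "A \<subseteq> C"
  unfolding assms(1) using assms(2,3) by (rule hull_minimal)

text \<open>
  The slope \<open>p/q\<close> is the largest one found on the generators of \<open>A\<close> and on \<open>x\<close>. Finite generation
  makes the maximum exist. It is non-negative since some generator of \<open>A\<close> is moved and elements of
  \<open>A\<close> have degree \<open>0\<close>.
\<close>
lemma not_rigid_base_of_polynomial_extension:
  assumes aff: "affine_algebra k A"
    and ext: "polynomial_extension A x"
    and D: "exponential_map k (adjoin A x) D"
    and moves: "\<not> A \<subseteq> invariants (adjoin A x) D"
  shows "\<not> rigid k A"
proof -
  interpret polynomial_extension A x by fact
  interpret exponential_map k "adjoin A x" D by fact
  obtain S where A: "k_domain k A" and S: "finite S" "A = k_domain k hull S"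
    using aff by (auto simp: affine_algebra_def)
  have SA: "S \<subseteq> A" unfolding S(2) by (rule hull_subset)
  interpret A: k_domain k A by fact
  have "\<not> S \<subseteq> invariants (adjoin A x) D"
    using hull_generators_subset[OF S(2) _ k_domain_invariants] moves by auto
  then obtain s0 n0 where s0: "s0 \<in> S" "n0 > 0" "D n0 s0 \<noteq> 0"
    using SA base_adjoin by (auto simp: invariants_iff subset_iff)
  have "insert x S \<subseteq> adjoin A x" "finite (insert x S)" using SA base_adjoin gen_adjoin S(1) by auto
  then obtain N where N: "\<And>b n. b \<in> insert x S \<Longrightarrow> n \<ge> N \<Longrightarrow> D n b = 0"
    using uniformly_locally_finite by metis
  \<comment> \<open>Integers, since the numerator for \<open>x\<close> is \<open>-1\<close> when \<open>D\<^sub>n(x)\<close> lies in \<open>A\<close>.\<close>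
  define deg where "deg r = int (degree (expansion r))" for r
  define WS where "WS = {(deg (D n a), n) | n a. a \<in> S \<and> n > 0 \<and> D n a \<noteq> 0}"
  define Wx where "Wx = {(deg (D n x) - 1, n) | n. n > 0 \<and> D n x \<noteq> 0}"
  define slope :: "int \<times> nat \<Rightarrow> rat" where "slope = (\<lambda>(u, n). of_int u / of_nat n)"
  have small: "n \<le> N" if "b \<in> insert x S" "D n b \<noteq> 0" for b n
    using N[OF that(1), of n] that(2) by (meson nat_le_linear)
  have "WS \<subseteq> (\<lambda>(n, a). (deg (D n a), n)) ` ({..N} \<times> S)"
  proof
    fix v assume "v \<in> WS"
    then obtain n a where v: "v = (deg (D n a), n)" "a \<in> S" "D n a \<noteq> 0" by (auto simp: WS_def)
    thus "v \<in> (\<lambda>(n, a). (deg (D n a), n)) ` ({..N} \<times> S)"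
      using small[of a n] by (intro image_eqI[of _ _ "(n, a)"]) auto
  qed
  moreover have "Wx \<subseteq> (\<lambda>n. (deg (D n x) - 1, n)) ` {..N}"
    using small by (auto simp: Wx_def)
  ultimately have fin: "finite (WS \<union> Wx)"
    using S(1) by (meson finite_Un finite_SigmaI finite_atMost finite_imageI finite_subset)
  have in_W: "(deg (D n0 s0), n0) \<in> WS \<union> Wx" using s0 by (auto simp: WS_def)
  have "Max (slope ` (WS \<union> Wx)) \<in> slope ` (WS \<union> Wx)"
    using fin in_W by (intro Max_in) auto
  then obtain p' q where pq: "(p', q) \<in> WS \<union> Wx" "Max (slope ` (WS \<union> Wx)) = slope (p', q)"
    by auto
  have q: "q > 0" using pq(1) by (auto simp: WS_def Wx_def)
  have bound: "u * int q \<le> p' * int n" if "(u, n) \<in> WS \<union> Wx" for u n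
  proof -
    have "n > 0" using that by (auto simp: WS_def Wx_def)
    have "slope (u, n) \<le> slope (p', q)"
      unfolding pq(2)[symmetric] using fin that by (intro Max_ge) auto
    hence "of_int (u * int q) \<le> (of_int (p' * int n) :: rat)"
      using q \<open>n > 0\<close> by (simp add: slope_def field_simps)
    thus ?thesis by (simp only: of_int_le_iff)
  qed
  have "0 \<le> p' * int n0" using bound[OF in_W] by (simp add: deg_def) (meson order.trans of_nat_0_le_iff mult_nonneg_nonneg)
  hence "p' \<ge> 0" using s0(2) by (simp add: zero_le_mult_iff)
  then obtain p where p: "p' = int p" using nonneg_int_cases by blast
  have nat_bound: "degree (weighted q r) \<le> m" if "deg r * int q \<le> int m" for r m
    using that by (simp add: weighted_degree deg_def flip: of_nat_mult)
  have "D n a \<in> filt q (p * n)" if "a \<in> S" for a n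
  proof (cases "n = 0 \<or> D n a = 0")
    case True
    thus ?thesis using that SA by (auto simp: zero base_adjoin filt_base)
  next
    case False
    hence "deg (D n a) * int q \<le> int (p * n)"
      using bound[of "deg (D n a)" n] that by (auto simp: WS_def p)
    thus ?thesis using that SA closed base_adjoin by (auto simp: filt_def intro: nat_bound)
  qed
  hence "S \<subseteq> {b \<in> adjoin A x. \<forall>n. D n b \<in> filt q (p * n)}" using SA base_adjoin by auto
  moreover have "k_domain k {b \<in> adjoin A x. \<forall>n. D n b \<in> filt q (p * n)}"
  proof (rule k_domain_slopes)
    fix n r s assume rs: "r \<in> filt q (p * n)" "s \<in> filt q (p * n)"
    have "0 - 1 \<in> A" by (intro is_subring_intros[OF base_subring])
    from filt_mult[OF filt_base[OF this, of q 0] rs(2)] have "- s \<in> filt q (p * n)" by simp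
    from filt_add[OF rs(1) this] show "r - s \<in> filt q (p * n)" by simp
  next
    fix i j r s assume "r \<in> filt q (p * i)" "s \<in> filt q (p * j)"
    thus "r * s \<in> filt q (p * (i + j))" using filt_mult by (simp add: distrib_left)
  next
    show "k \<subseteq> filt q (p * 0)" using A.subset filt_base by auto
  qed simp
  ultimately have slope_A: "A \<subseteq> {b \<in> adjoin A x. \<forall>n. D n b \<in> filt q (p * n)}"
    by (rule hull_generators_subset[OF S(2)])
  have slope_x: "D n x \<in> filt q (q + p * n)" for n
  proof (cases "n = 0 \<or> D n x = 0")
    case True
    thus ?thesis using filt_gen[of q] by (auto simp: zero gen_adjoin)
  next
    case False
    hence "(deg (D n x) - 1) * int q \<le> int (p * n)"
      using bound[of "deg (D n x) - 1" n] by (auto simp: Wx_def p)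
    hence "deg (D n x) * int q \<le> int (q + p * n)" by (simp add: algebra_simps)
    thus ?thesis using closed gen_adjoin by (auto simp: filt_def intro: nat_bound)
  qed
  interpret slope_bounded A x k D p q
    using q slope_A slope_x A by unfold_locales auto
  have "(\<exists>a\<in>A. D q a \<noteq> 0 \<and> degree (w (D q a)) = p * q) \<or>
      (D q x \<noteq> 0 \<and> degree (w (D q x)) = q + p * q)"
    using pq(1)
  proof
    assume "(p', q) \<in> WS"
    then obtain a where "a \<in> S" "D q a \<noteq> 0" "int (degree (expansion (D q a))) = int p"
      by (auto simp: WS_def p deg_def)
    thus ?thesis using SA by (auto simp: weighted_degree)
  next
    assume "(p', q) \<in> Wx"
    hence "D q x \<noteq> 0" "int (degree (expansion (D q x))) = int (Suc p)"
      by (auto simp: Wx_def p deg_def)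
    thus ?thesis by (simp only: of_nat_eq_iff weighted_degree) simp
  qed
  hence "nontrivial_exp A induced" by (rule induced_nontrivial[OF q])
  thus ?thesis using exponential_map_induced by (auto simp: rigid_def)
qed

section \<open>Invariant rings with a quasi-basic plinth element\<close>

text \<open>
  Only finitely many elements \<open>\<gamma>\<^sub>n b\<close> with \<open>b\<close> equal to \<open>x\<close> or a generator of \<open>A\<close> are non-zero, so one
  power \<open>f\<^sup>M\<close> moves all of them into \<open>A[x]\<close>. Rescaling \<open>\<gamma>\<close> by \<open>f\<^sup>M\<close> then maps \<open>A[x]\<close> to itself, and it
  still moves \<open>A\<close> because \<open>f \<noteq> 0\<close>.
\<close>
lemma not_rigid_invariants:
  assumes \<delta>: "exponential_map k B \<delta>" and aff: "affine_algebra k (invariants B \<delta>)"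
    and x: "local_slice B \<delta> x"
    and \<gamma>: "exponential_map k B \<gamma>" and moves: "\<not> invariants B \<delta> \<subseteq> invariants B \<gamma>"
    and f\<gamma>: "lead_coeff (exp_poly \<delta> x) \<in> invariants B \<gamma>"
  shows "\<not> rigid k (invariants B \<delta>)"
proof -
  interpret d: exponential_map k B \<delta> by fact
  interpret g: exponential_map k B \<gamma> by fact
  define A f where "A = invariants B \<delta>" and "f = lead_coeff (exp_poly \<delta> x)"
  define R where "R = adjoin A x"
  have xB: "x \<in> B" and "degree (exp_poly \<delta> x) > 0" using x by (auto simp: local_slice_def)
  hence f: "f \<in> A" "f \<noteq> 0" unfolding f_def A_def using d.lead_coeff_invariant by auto
  have A: "is_subring A" "A \<subseteq> B" unfolding A_def by (rule d.is_subring_invariants d.invariants_subset)+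
  have R: "is_subring R" "A \<subseteq> R" "x \<in> R" "R \<subseteq> B"
    unfolding R_def using A xB d.subring
    by (auto intro: is_subring_adjoin in_adjoin base_subset_adjoin[THEN subsetD] adjoin_subset[THEN subsetD])
  have kA: "k \<subseteq> A" unfolding A_def by (rule d.base_invariant)
  obtain S where S: "finite S" "A = k_domain k hull S"
    using aff by (auto simp: affine_algebra_def A_def)
  have SA: "S \<subseteq> A" unfolding S(2) by (rule hull_subset)
  have fR: "f ^ i \<in> R" for i using is_subring_power[OF A(1) f(1)] R(2) by auto
  have "finite (insert x S)" "insert x S \<subseteq> B" using S(1) SA A(2) xB by auto
  then obtain N where N: "\<And>b n. b \<in> insert x S \<Longrightarrow> n \<ge> N \<Longrightarrow> \<gamma> n b = 0"
    using g.uniformly_locally_finite by metis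
  have common: "\<exists>M. \<forall>v\<in>V. f ^ M * v \<in> R" if "finite V" "V \<subseteq> B" for V
    using that
  proof (induction V)
    case (insert v V)
    then obtain M where M: "\<forall>v\<in>V. f ^ M * v \<in> R" by auto
    obtain M' where M': "f ^ M' * v \<in> R"
      using d.local_slice_generates[OF x, of v] insert by (auto simp: f_def R_def A_def)
    have "f ^ (M + M') * u \<in> R" if "u \<in> insert v V" for u
    proof (cases "u = v")
      case True
      thus ?thesis using is_subring_mult[OF R(1) fR[of M] M'] by (simp add: power_add mult_ac)
    next
      case False
      hence "f ^ M * u \<in> R" using M that by auto
      from is_subring_mult[OF R(1) fR[of M'] this] show ?thesis by (simp add: power_add mult_ac)
    qed
    thus ?case by blast
  qed auto
  define V where "V = (\<lambda>(n, b). \<gamma> n b) ` ({..<N} \<times> insert x S)"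
  have "finite V" "V \<subseteq> B"
    unfolding V_def using \<open>finite (insert x S)\<close> \<open>insert x S \<subseteq> B\<close> g.closed by (auto simp: subset_iff)
  then obtain M where M: "\<forall>v\<in>V. f ^ M * v \<in> R" using common by blast
  define E where "E = (\<lambda>n b. (f ^ M) ^ n * \<gamma> n b)"
  have fMi: "f ^ M \<in> invariants B \<gamma>"
    using f\<gamma> is_subring_power[OF g.is_subring_invariants] by (simp add: f_def)
  interpret E: exponential_map k B E
    unfolding E_def using fMi by (rule g.exponential_map_rescale)
  have gens: "E n b \<in> R" if "b \<in> insert x S" for n b
  proof -
    consider "n = 0" | "n \<ge> N" | "n > 0" "n < N" by linarith
    thus ?thesis
    proof cases
      case 1
      have "b \<in> B" "b \<in> R" using that SA R A by auto
      thus ?thesis using 1 by (simp add: E.zero)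
    next
      case 2
      thus ?thesis using N[OF that] is_subring_zero[OF R(1)] by (simp add: E_def)
    next
      case 3
      hence "f ^ M * \<gamma> n b \<in> R" using M that by (auto simp: V_def)
      hence "f ^ (M * (n - 1)) * (f ^ M * \<gamma> n b) \<in> R" by (rule is_subring_mult[OF R(1) fR])
      also have "f ^ (M * (n - 1)) * (f ^ M * \<gamma> n b) = E n b"
        using 3 by (cases n) (auto simp: E_def power_add mult_ac simp flip: power_mult)
      finally show ?thesis .
    qed
  qed
  have stable: "k_domain k {b \<in> B. \<forall>n. E n b \<in> R}"
    using R kA by (intro E.k_domain_slopes) (auto intro: is_subring_intros[OF R(1)])
  have "A \<subseteq> {b \<in> B. \<forall>n. E n b \<in> R}"
    using gens SA A by (intro hull_generators_subset[OF S(2) _ stable]) auto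
  hence "R \<subseteq> {b \<in> B. \<forall>n. E n b \<in> R}"
    unfolding R_def using gens xB stable unfolding R_def
    by (intro adjoin_subset) (auto simp: k_domain_def)
  hence ER: "exponential_map k R E"
    using R kA d.subfield by (intro E.exponential_map_restrict k_domainI) auto
  interpret ER: exponential_map k R E by fact
  have ext: "polynomial_extension A x"
    using A d.local_slice_transcendental[OF x] by unfold_locales (auto simp: A_def)
  have "\<not> A \<subseteq> invariants R E"
  proof
    assume inv: "A \<subseteq> invariants R E"
    have "a \<in> invariants B \<gamma>" if "a \<in> A" for a
      using subsetD[OF inv that, unfolded ER.invariants_iff] f(2) that A(2)
      by (auto simp: g.invariants_iff E_def)
    thus False using moves by (auto simp: A_def)
  qed
  thus ?thesis
    using not_rigid_base_of_polynomial_extension[OF aff[folded A_def] ext, of E] ER by (simp add: R_def A_def)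
qed

theorem theorem3p6:
  fixes k B :: "'b::idom set" and \<delta> :: "nat \<Rightarrow> 'b \<Rightarrow> 'b"
  assumes "k_domain k B"
    and "exponential_map k B \<delta>"
    and "affine_algebra k (invariants B \<delta>)"
    and "\<exists>x \<in> plinth B \<delta>. quasi_basic k B x"
  shows "\<not> rigid k (invariants B \<delta>)"
proof -
  obtain f \<alpha> \<beta> where f: "f \<in> plinth B \<delta>" "f \<noteq> 0"
    and \<alpha>: "exponential_map k B \<alpha>" "nontrivial_exp B \<alpha>" "f \<in> invariants B \<alpha>"
    and \<beta>: "exponential_map k B \<beta>" "nontrivial_exp B \<beta>" "f \<in> invariants B \<beta>"
    and ne: "invariants B \<alpha> \<noteq> invariants B \<beta>"
    using assms(4) by (auto simp: quasi_basic_def)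
  obtain x where x: "local_slice B \<delta> x" and fx: "f = lead_coeff (exp_poly \<delta> x)"
    using f by (auto simp: plinth_def)
  have "\<not> (invariants B \<delta> \<subseteq> invariants B \<alpha> \<and> invariants B \<delta> \<subseteq> invariants B \<beta>)"
    using invariants_subset_imp_eq[OF assms(2) \<alpha>(1,2) x]
      invariants_subset_imp_eq[OF assms(2) \<beta>(1,2) x] ne by auto
  thus ?thesis
    using not_rigid_invariants[OF assms(2,3) x \<alpha>(1)] not_rigid_invariants[OF assms(2,3) x \<beta>(1)]
      \<alpha>(3) \<beta>(3) fx by blast
qed

end
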